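(* Let $N=2^{n}$ with $n\in\mathbb{N}^{+}$, and let $K_u\ge 2$ be an integer. Call a tuple of integers $(m_0,m_1,\dots,m_{K_u-1})$ admissible if $0<m_0<m_1<\cdots<m_{K_u-1}<N$ and $\gcd(m_u,N)=1$ for every $u$. For an admissible tuple let $\psi_{\max}$ be the maximum cross-correlation of the associated Zadoff-Chu sequences and let $\psi_{\max}^{(u,v)}$ be the maximum cross-correlation of the pair $(u,v)$, as defined in the context. Then an arithmetic progression with common difference $2$, namely $m_u=2u+m_0$ for $u=0,1,\dots,K_u-1$ (with $m_0>0$ and $2(K_u-1)+m_0<N$), where $m_0$ must be odd in order that $\gcd(m_u,N)=1$ for all $u$, is an optimal selection of the roots in the following sense: among all admissible tuples it minimizes $\psi_{\max}$, and among all admissible tuples attaining this minimum value of $\psi_{\max}$ it minimizes the number of unordered pairs $\{u,v\}$, $u\neq v$, with $\psi_{\max}^{(u,v)}=\psi_{\max}$.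
   Context: $N=2^n$ is the sequence length and $(a)_N$ denotes the residue of the integer $a$ modulo $N$ in $\{0,\dots,N-1\}$. Given integer roots $m_u$ with $0<m_u<N$ and $\gcd(m_u,N)=1$, the Zadoff-Chu sequence of index $u$ (for even $N$) is $$z_u[k]=\frac{1}{\sqrt N}\,e^{j\pi m_u k^2/N},\qquad k=0,1,\dots,N-1,$$ where $j$ is the imaginary unit. For indices $u,v$ and $k_u,k_v\in\{0,\dots,N-1\}$ the cross-correlation is $$\psi_{u,v}(k_u,k_v)=\sum_{k=0}^{N-1} z_u^{*}[(k-k_u)_N]\,z_v[(k-k_v)_N],$$ with $^*$ denoting complex conjugation. For $u\neq v$, $$\psi_{\max}^{(u,v)}=\max_{0\le k_u,k_v\le N-1}|\psi_{u,v}(k_u,k_v)|,\qquad \psi_{\max}=\max_{u\neq v}\psi_{\max}^{(u,v)},$$ where $u,v$ range over $\{0,1,\dots,K_u-1\}$. The symbol $K_u$ denotes the number of sequences (users); its subscript is part of the name and is unrelated to the index $u$. *)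

theory Defs
  imports Complex_Main
begin

definition zadoff_chu :: "nat \<Rightarrow> int \<Rightarrow> int \<Rightarrow> complex" where
  "zadoff_chu N r k =
     complex_of_real (1 / sqrt (real N)) *
     exp (\<i> * complex_of_real pi * of_int r * (of_int k)\<^sup>2 / of_nat N)"

text \<open>A tuple of roots indexed by \<open>0, \<dots>, K - 1\<close> is a function \<open>m :: nat \<Rightarrow> int\<close> of which only
  the values below \<open>K\<close> matter.\<close>

definition cross_corr :: "nat \<Rightarrow> (nat \<Rightarrow> int) \<Rightarrow> nat \<Rightarrow> nat \<Rightarrow> int \<Rightarrow> int \<Rightarrow> complex" where
  "cross_corr N m u v k\<^sub>u k\<^sub>v =
     (\<Sum>k\<in>{0..<int N}. cnj (zadoff_chu N (m u) ((k - k\<^sub>u) mod int N)) *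
                       zadoff_chu N (m v) ((k - k\<^sub>v) mod int N))"

definition psi_max_pair :: "nat \<Rightarrow> (nat \<Rightarrow> int) \<Rightarrow> nat \<Rightarrow> nat \<Rightarrow> real" where
  "psi_max_pair N m u v =
     Max {cmod (cross_corr N m u v k\<^sub>u k\<^sub>v) | k\<^sub>u k\<^sub>v.
            k\<^sub>u \<in> {0..<int N} \<and> k\<^sub>v \<in> {0..<int N}}"

text \<open>The maxima are over finite sets, nonempty for \<open>N \<ge> 1\<close> and \<open>K \<ge> 2\<close> respectively.\<close>

definition psi_max :: "nat \<Rightarrow> nat \<Rightarrow> (nat \<Rightarrow> int) \<Rightarrow> real" where
  "psi_max N K m = Max {psi_max_pair N m u v | u v. u < K \<and> v < K \<and> u \<noteq> v}"

definition admissible :: "nat \<Rightarrow> nat \<Rightarrow> (nat \<Rightarrow> int) \<Rightarrow> bool" where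
  "admissible N K m \<longleftrightarrow>
     strict_mono_on {..<K} m \<and>
     (\<forall>u<K. 0 < m u \<and> m u < int N \<and> gcd (m u) (int N) = 1)"

text \<open>Unordered pairs are two-element sets of indices.\<close>

definition num_max_pairs :: "nat \<Rightarrow> nat \<Rightarrow> (nat \<Rightarrow> int) \<Rightarrow> nat" where
  "num_max_pairs N K m =
     card {{u, v} | u v. u < K \<and> v < K \<and> u \<noteq> v \<and> psi_max_pair N m u v = psi_max N K m}"

definition minimizes_psi_max :: "nat \<Rightarrow> nat \<Rightarrow> (nat \<Rightarrow> int) \<Rightarrow> bool" where
  "minimizes_psi_max N K m \<longleftrightarrow> is_arg_min (psi_max N K) (admissible N K) m"

definition optimal_roots :: "nat \<Rightarrow> nat \<Rightarrow> (nat \<Rightarrow> int) \<Rightarrow> bool" where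
  "optimal_roots N K m \<longleftrightarrow> is_arg_min (num_max_pairs N K) (minimizes_psi_max N K) m"

end

theory Submission
  imports Defs "HOL-Computational_Algebra.Primes"
begin

text \<open>For roots differing by \<open>d\<close>, with \<open>0 < \<bar>d\<bar> < N\<close>, the cross-correlation is up to a phase a
  quadratic Gauss sum divided by \<open>N\<close>; expanding its squared modulus shows that the pair has
  maximum \<open>sqrt (gcd d N / N)\<close>. If \<open>M\<close> is the power of two with \<open>M < K \<le> 2 * M\<close>, then \<open>K\<close> odd
  numbers fall into \<open>M\<close> odd classes modulo \<open>2 * M\<close>, which forces at least \<open>K - M\<close> pairs to agree
  modulo \<open>2 * M\<close>. For the progression with difference \<open>2\<close> these are exactly the \<open>K - M\<close> pairs at
  index distance \<open>M\<close>, and no pair agrees modulo \<open>4 * M\<close>.\<close>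

section \<open>Quadratic Gauss sums\<close>

text \<open>The denominator \<open>N\<close> together with \<open>pi\<close> (not \<open>2 * pi\<close>) makes this a character of period \<open>2 * N\<close>.\<close>

definition half_root :: "nat \<Rightarrow> int \<Rightarrow> complex" where
  "half_root N k = cis (pi * real_of_int k / real N)"

lemma half_root_add: "half_root N (a + b) = half_root N a * half_root N b"
  by (simp add: half_root_def cis_mult add_divide_distrib distrib_left)

lemma half_root_0 [simp]: "half_root N 0 = 1"
  by (simp add: half_root_def)

lemma cnj_half_root: "cnj (half_root N a) = half_root N (- a)"
  by (simp add: half_root_def cis_cnj)

lemma cmod_half_root [simp]: "cmod (half_root N a) = 1"
  by (simp add: half_root_def)

lemma half_root_period:
  assumes "N > 0" "2 * int N dvd a"
  shows "half_root N a = 1"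
proof -
  obtain c where c: "a = 2 * int N * c" using assms(2) by blast
  have "pi * real_of_int a / real N = 2 * pi * real_of_int c"
    using assms(1) by (simp add: c)
  then show ?thesis
    by (simp add: half_root_def cis_multiple_2pi)
qed

lemma half_root_cong:
  assumes "N > 0" "2 * int N dvd a - b"
  shows "half_root N a = half_root N b"
  using half_root_add[of N "a - b" b] half_root_period[OF assms] by simp

text \<open>Doubling the exponent turns the period \<open>2 * N\<close> into \<open>N\<close>, so
  the sums over \<open>k\<close> below are geometric sums of \<open>N\<close>-th roots of
  unity.\<close>

lemma half_root_eq_1_iff:
  assumes "N > 0"
  shows "half_root N (2 * a) = 1 \<longleftrightarrow> int N dvd a"
proof
  assume "half_root N (2 * a) = 1"
  then have "cos (pi * real_of_int (2 * a) / real N) = 1"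
    by (simp add: half_root_def complex_eq_iff)
  then obtain c :: int where "pi * real_of_int (2 * a) / real N = real_of_int c * 2 * pi"
    by (auto simp: cos_one_2pi_int)
  then have "real_of_int a = real_of_int (c * int N)"
    using assms by (simp add: field_simps)
  then have "a = c * int N" by linarith
  then show "int N dvd a" by simp
next
  assume "int N dvd a"
  then show "half_root N (2 * a) = 1"
    using assms by (intro half_root_period) auto
qed

lemma half_root_scale:
  assumes "q > 0"
  shows "half_root (g * q) (int q * a) = half_root g a"
  using assms by (simp add: half_root_def)

lemma half_root_power: "half_root N (a * int k) = half_root N a ^ k"
  by (simp add: half_root_def DeMoivre algebra_simps)

lemma sum_half_root:
  assumes "N > 0"
  shows "(\<Sum>k\<in>{0..<int N}. half_root N (2 * a * k)) = (if int N dvd a then of_nat N else 0)"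
proof -
  define w where "w = half_root N (2 * a)"
  have "(\<Sum>k\<in>{0..<int N}. half_root N (2 * a * k)) = (\<Sum>k<N. half_root N (2 * a * int k))"
    by (rule sum.reindex_bij_witness[of _ int nat]) auto
  also have "\<dots> = (\<Sum>k<N. w ^ k)"
    by (simp only: half_root_power w_def)
  finally have eq: "(\<Sum>k\<in>{0..<int N}. half_root N (2 * a * k)) = (\<Sum>k<N. w ^ k)" .
  have "w ^ N = half_root N (2 * a * int N)"
    by (simp only: half_root_power w_def)
  then have "w ^ N = 1"
    using assms by (simp add: half_root_period)
  then have "w \<noteq> 1 \<Longrightarrow> (\<Sum>k<N. w ^ k) = 0"
    by (simp add: geometric_sum)
  then show ?thesis
    using half_root_eq_1_iff[OF assms, of a] eq by (auto simp: w_def)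
qed

lemma sum_periodic_shift:
  fixes f :: "int \<Rightarrow> 'a :: comm_monoid_add"
  assumes "N > 0" and per: "\<And>k. f (k mod N) = f k"
  shows "(\<Sum>k\<in>{0..<N}. f (k + c)) = (\<Sum>k\<in>{0..<N}. f k)"
proof -
  have "(\<Sum>k\<in>{0..<N}. f ((k + c) mod N)) = (\<Sum>k\<in>{0..<N}. f k)"
    by (rule sum.reindex_bij_witness[of _ "\<lambda>k. (k - c) mod N" "\<lambda>k. (k + c) mod N"])
       (use assms(1) in \<open>auto simp: mod_simps\<close>)
  then show ?thesis by (simp add: per)
qed

text \<open>A generalized quadratic Gauss sum. The factor 2 in the linear term ensures that, for
  even \<open>N\<close>, the summand depends only on \<open>k\<close> modulo
  \<open>N\<close>.\<close>

definition gauss_sum :: "nat \<Rightarrow> int \<Rightarrow> int \<Rightarrow> complex" where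
  "gauss_sum N d b = (\<Sum>k\<in>{0..<int N}. half_root N (d * k\<^sup>2 - 2 * b * k))"

text \<open>Evenness of \<open>N\<close> makes \<open>N\<^sup>2\<close> a multiple of
  \<open>2 * N\<close>. Hence quadratic phases, a priori of period \<open>2 * N\<close>, already
  have period \<open>N\<close>.\<close>

lemma dvd_diff_square_mod:
  fixes k :: int
  assumes "even N"
  shows "2 * N dvd (k mod N)\<^sup>2 - k\<^sup>2" "2 * N dvd 2 * (k mod N) - 2 * k"
proof -
  define q where "q = k div N"
  have k: "k mod N = k - N * q"
    by (simp add: q_def minus_mult_div_eq_mod)
  obtain c where c: "N = 2 * c" using assms by blast
  have "(k mod N)\<^sup>2 - k\<^sup>2 = 2 * N * (c * q\<^sup>2 - q * k)"
    unfolding k by (simp add: c power2_eq_square algebra_simps)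
  then show "2 * N dvd (k mod N)\<^sup>2 - k\<^sup>2" by simp
  have "2 * (k mod N) - 2 * k = 2 * N * (- q)"
    unfolding k by algebra
  then show "2 * N dvd 2 * (k mod N) - 2 * k" by (metis dvd_triv_left)
qed

text \<open>Weyl differencing: after the shift by \<open>k\<close>, the phase is linear in
  \<open>k\<close>, so the sum over \<open>k\<close> vanishes unless \<open>q\<close> divides
  \<open>h\<close>. The \<open>g\<close> surviving values \<open>h = q * t\<close> leave a linear
  character sum modulo \<open>g\<close>.\<close>

lemma gauss_sum_norm_square:
  assumes N: "N = g * q" and "N > 0" and g: "int g = gcd d (int N)" and "even q"
  shows "gauss_sum N d b * cnj (gauss_sum N d b) = (if int g dvd b then of_nat (N * g) else 0)"
proof -
  have pos: "g > 0" "q > 0" using N \<open>N > 0\<close> by auto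
  have evN: "even (int N)" using N \<open>even q\<close> by simp
  define f where "f = (\<lambda>k. half_root N (d * k\<^sup>2 - 2 * b * k))"
  have per: "f (k mod int N) = f k" for k
  proof -
    have "2 * int N dvd d * ((k mod int N)\<^sup>2 - k\<^sup>2) - b * (2 * (k mod int N) - 2 * k)"
      by (intro dvd_diff dvd_mult dvd_diff_square_mod evN)
    then show ?thesis unfolding f_def
      by (intro half_root_cong \<open>N > 0\<close>) (simp add: algebra_simps)
  qed
  obtain d' where d': "d = int g * d'" using g by (metis gcd_dvd1 dvd_def)
  have cop: "coprime d' (int q)"
  proof -
    have "int g * gcd d' (int q) = gcd d (int N)"
      using gcd_mult_distrib_int[of "int g" d' "int q"] by (simp add: d' N)
    then show ?thesis using g pos \<open>N > 0\<close> by (simp add: coprime_iff_gcd_eq_1)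
  qed
  \<comment> \<open>Cancelling \<open>g\<close> leaves \<open>d' * h\<close> modulo
    \<open>q\<close>, where \<open>d'\<close> is a unit.\<close>
  have dvd_iff: "int N dvd d * h \<longleftrightarrow> int q dvd h" for h
    using pos cop by (simp add: N d' mult.assoc coprime_commute coprime_dvd_mult_right_iff)
  have step: "f (h + k) * cnj (f k) = f h * half_root N (2 * (d * h) * k)" for h k
    unfolding f_def cnj_half_root half_root_add[symmetric]
    by (rule arg_cong[of _ _ "half_root N"]) algebra
  have shift: "(\<Sum>h\<in>{0..<int N}. f (h + k)) = (\<Sum>h\<in>{0..<int N}. f h)" for k
    using \<open>N > 0\<close> per by (intro sum_periodic_shift) auto
  have "gauss_sum N d b * cnj (gauss_sum N d b) =
      (\<Sum>k\<in>{0..<int N}. (\<Sum>h\<in>{0..<int N}. f h) * cnj (f k))"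
    by (simp add: gauss_sum_def f_def sum_distrib_left)
  also have "\<dots> = (\<Sum>k\<in>{0..<int N}. \<Sum>h\<in>{0..<int N}. f (h + k) * cnj (f k))"
    by (simp only: shift sum_distrib_right[symmetric])
  also have "\<dots> = (\<Sum>h\<in>{0..<int N}. f h * (\<Sum>k\<in>{0..<int N}. half_root N (2 * (d * h) * k)))"
    by (subst sum.swap) (simp add: step sum_distrib_left)
  also have "\<dots> = (\<Sum>h\<in>{0..<int N}. if int q dvd h then of_nat N * f h else 0)"
    by (intro sum.cong refl) (simp only: sum_half_root[OF \<open>N > 0\<close>] dvd_iff, simp)
  also have "\<dots> = (\<Sum>h\<in>{h \<in> {0..<int N}. int q dvd h}. of_nat N * f h)"
    by (rule sum.inter_filter[symmetric]) simp
  also have "\<dots> = (\<Sum>t\<in>{0..<int g}. of_nat N * f (int q * t))"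
    by (rule sum.reindex_bij_witness[of _ "\<lambda>t. int q * t" "\<lambda>h. h div int q"])
       (use pos in \<open>auto simp: N zero_le_mult_iff pos_imp_zdiv_nonneg_iff mult.commute
                          elim!: dvdE\<close>)
  also have "\<dots> = (\<Sum>t\<in>{0..<int g}. of_nat N * half_root g (2 * (- b) * t))"
  proof (intro sum.cong refl arg_cong[of _ _ "(*) (of_nat N)"])
    fix t
    obtain p where p: "int q = 2 * p" using \<open>even q\<close> by (metis even_of_nat dvd_def)
    \<comment> \<open>With \<open>q = 2 * p\<close> the quadratic part is a multiple of
      \<open>2 * N\<close> and drops out of the phase; only the linear part remains.\<close>
    have "d * (int q * t)\<^sup>2 - 2 * b * (int q * t) - int q * (2 * (- b) * t) =
        2 * int N * (d' * p * t\<^sup>2)"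
      unfolding d' N of_nat_mult p by algebra
    then have "f (int q * t) = half_root N (int q * (2 * (- b) * t))"
      unfolding f_def by (intro half_root_cong \<open>N > 0\<close>) simp
    then show "f (int q * t) = half_root g (2 * (- b) * t)"
      unfolding N by (simp only: half_root_scale[OF pos(2)])
  qed
  also have "\<dots> = of_nat N * (if int g dvd - b then of_nat g else 0)"
    by (simp only: sum_distrib_left[symmetric] sum_half_root[OF pos(1)])
  also have "\<dots> = (if int g dvd b then of_nat (N * g) else 0)" by simp
  finally show ?thesis .
qed

lemma cmod_gauss_sum:
  assumes "N = g * q" "N > 0" "int g = gcd d (int N)" "even q"
  shows "cmod (gauss_sum N d b) = (if int g dvd b then sqrt (real (N * g)) else 0)"
proof -
  have "complex_of_real ((cmod (gauss_sum N d b))\<^sup>2) =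
      complex_of_real (if int g dvd b then real (N * g) else 0)"
    by (simp only: complex_norm_square gauss_sum_norm_square[OF assms]) simp
  then have "(cmod (gauss_sum N d b))\<^sup>2 = (if int g dvd b then real (N * g) else 0)"
    by (simp only: of_real_eq_iff)
  then have "cmod (gauss_sum N d b) = sqrt (if int g dvd b then real (N * g) else 0)"
    by (metis real_sqrt_unique norm_ge_zero)
  then show ?thesis by (simp only: if_distrib[of sqrt] real_sqrt_zero)
qed

section \<open>Cross-correlation of a pair\<close>

lemma zadoff_chu_half_root:
  "zadoff_chu N r k = complex_of_real (1 / sqrt (real N)) * half_root N (r * k\<^sup>2)"
  unfolding zadoff_chu_def half_root_def cis_conv_exp
  by (simp add: mult_ac)

lemma zadoff_chu_mod:
  assumes "even N" "N > 0"
  shows "zadoff_chu N r (k mod int N) = zadoff_chu N r k"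
proof -
  have "2 * int N dvd r * ((k mod int N)\<^sup>2 - k\<^sup>2)"
    using dvd_diff_square_mod(1)[of "int N" k] assms(1) by simp
  then have "half_root N (r * (k mod int N)\<^sup>2) = half_root N (r * k\<^sup>2)"
    by (intro half_root_cong assms(2)) (simp only: right_diff_distrib)
  then show ?thesis by (simp only: zadoff_chu_half_root)
qed

text \<open>Periodicity removes the residues, and expanding both squares splits off a phase
  independent of \<open>k\<close>. The two factors \<open>1 / sqrt N\<close> give
  \<open>1 / N\<close>.\<close>

lemma cmod_cross_corr:
  assumes "even N" "N > 0"
  shows "cmod (cross_corr N m u v a b) =
    cmod (gauss_sum N (m v - m u) (m v * b - m u * a)) / real N"
proof -
  have scale: "complex_of_real (1 / sqrt (real N)) * complex_of_real (1 / sqrt (real N)) =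
      complex_of_real (1 / real N)"
    by (subst of_real_mult[symmetric]) simp
  have "cnj (zadoff_chu N (m u) ((k - a) mod int N)) * zadoff_chu N (m v) ((k - b) mod int N) =
      complex_of_real (1 / real N) * half_root N (m v * b\<^sup>2 - m u * a\<^sup>2) *
        half_root N ((m v - m u) * k\<^sup>2 - 2 * (m v * b - m u * a) * k)" for k
  proof -
    have "- (m u * (k - a)\<^sup>2) + m v * (k - b)\<^sup>2 =
        (m v * b\<^sup>2 - m u * a\<^sup>2) + ((m v - m u) * k\<^sup>2 - 2 * (m v * b - m u * a) * k)"
      by algebra
    then have *: "half_root N (- (m u * (k - a)\<^sup>2)) * half_root N (m v * (k - b)\<^sup>2) =
        half_root N (m v * b\<^sup>2 - m u * a\<^sup>2) *
        half_root N ((m v - m u) * k\<^sup>2 - 2 * (m v * b - m u * a) * k)"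
      by (metis half_root_add)
    have "cnj (zadoff_chu N (m u) ((k - a) mod int N)) * zadoff_chu N (m v) ((k - b) mod int N) =
       (complex_of_real (1 / sqrt (real N)) * complex_of_real (1 / sqrt (real N))) *
       (half_root N (- (m u * (k - a)\<^sup>2)) * half_root N (m v * (k - b)\<^sup>2))"
      unfolding zadoff_chu_mod[OF assms]
      by (simp only: zadoff_chu_half_root complex_cnj_mult
          cnj_half_root complex_cnj_complex_of_real mult_ac)
    then show ?thesis by (simp only: scale * mult.assoc)
  qed
  then have "cross_corr N m u v a b =
      complex_of_real (1 / real N) * half_root N (m v * b\<^sup>2 - m u * a\<^sup>2) *
      gauss_sum N (m v - m u) (m v * b - m u * a)"
    by (simp only: cross_corr_def gauss_sum_def sum_distrib_left)
  then show ?thesis by (simp add: norm_mult norm_divide)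
qed

lemma dvd_two_power_nat:
  fixes g :: nat
  assumes "g dvd 2 ^ n"
  obtains i where "i \<le> n" "g = 2 ^ i"
  using divides_primepow_nat[of 2 g n] assms by auto

text \<open>As the shifts vary, the correlation has modulus 0 or \<open>sqrt (g / N)\<close>, where
  \<open>g\<close> is the gcd, and the second value is attained.\<close>

lemma psi_max_pair_eq:
  assumes N: "N = 2 ^ n" and d: "m v \<noteq> m u" "\<bar>m v - m u\<bar> < int N"
  shows "psi_max_pair N m u v = sqrt (gcd (m v - m u) (int N) / real N)"
proof -
  define g where "g = nat (gcd (m v - m u) (int N))"
  have g: "int g = gcd (m v - m u) (int N)" by (simp add: g_def)
  have "N > 0" using N by simp
  have "int g dvd int N" by (simp add: g)
  then have "g dvd 2 ^ n" unfolding N by (simp only: int_dvd_int_iff)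
  then obtain i where i: "i \<le> n" "g = 2 ^ i" by (rule dvd_two_power_nat)
  \<comment> \<open>The bound on the difference forces \<open>g < N\<close>. Thus
    \<open>N / g\<close> is a power of two with positive exponent, hence even, as the Gauss sum
    evaluation requires.\<close>
  have "int g \<le> \<bar>m v - m u\<bar>" 
    using dvd_imp_le_int[of "m v - m u" "int g"] d(1) by (simp add: g)
  then have "g < N" using d(2) by simp
  then have "i < n" using i N by simp
  define q :: nat where "q = 2 ^ (n - i)"
  have q: "N = g * q" "even q"
    using \<open>i < n\<close> i N by (auto simp: q_def power_add[symmetric])
  have "even N" using q by simp
  define s where "s = sqrt (real g / real N)"
  have s: "sqrt (real (N * g)) / real N = s"
    using \<open>N > 0\<close> by (simp add: s_def real_sqrt_mult real_sqrt_divide real_div_sqrt field_simps)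
  have val: "cmod (cross_corr N m u v a b) = (if int g dvd m v * b - m u * a then s else 0)" for a b
    by (simp only: cmod_cross_corr[OF \<open>even N\<close> \<open>N > 0\<close>] cmod_gauss_sum[OF q(1) \<open>N > 0\<close> g q(2)] s[symmetric])
       simp
  have "psi_max_pair N m u v = s"
    unfolding psi_max_pair_def
  proof (rule Max_eqI)
    have "{cmod (cross_corr N m u v a b) |a b. a \<in> {0..<int N} \<and> b \<in> {0..<int N}} \<subseteq> {0, s}"
      by (auto simp: val)
    then show "finite {cmod (cross_corr N m u v a b) |a b. a \<in> {0..<int N} \<and> b \<in> {0..<int N}}"
      by (rule finite_subset) simp
    show "y \<le> s" if "y \<in> {cmod (cross_corr N m u v a b) |a b. a \<in> {0..<int N} \<and> b \<in> {0..<int N}}" for y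
      using that by (auto simp: val s_def)
    \<comment> \<open>Zero shifts make the linear coefficient 0, which \<open>g\<close>
      divides.\<close>
    have "cmod (cross_corr N m u v 0 0) = s" by (simp add: val)
    then show "s \<in> {cmod (cross_corr N m u v a b) |a b. a \<in> {0..<int N} \<and> b \<in> {0..<int N}}"
      using \<open>N > 0\<close> by force
  qed
  then show ?thesis by (simp add: s_def g[symmetric])
qed

section \<open>Counting pairs of congruent roots\<close>

text \<open>Fix one representative in each fibre of \<open>f\<close> and pair every other element
  with its representative. These pairs are distinct, since each contains exactly one element that is
  not a representative.\<close>

lemma card_collisions_ge:
  assumes "finite A"
  shows "card A - card (f ` A) \<le> card {{x, y} |x y. x \<in> A \<and> y \<in> A \<and> x \<noteq> y \<and> f x = f y}"
    (is "_ \<le> card ?P")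
proof -
  define r where "r x = inv_into A f (f x)" for x
  have r: "r x \<in> A" "f (r x) = f x" if "x \<in> A" for x
    using that by (auto simp: r_def inv_into_into f_inv_into_f)
  have "card (r ` A) = card (inv_into A f ` f ` A)"
    by (simp add: r_def image_image)
  then have card_r: "card (r ` A) = card (f ` A)"
    by (simp add: card_image inj_on_inv_into)
  have "card A - card (f ` A) = card (A - r ` A)"
    using assms r by (subst card_Diff_subset) (auto simp: card_r)
  also have "\<dots> \<le> card ?P"
  proof (rule card_inj_on_le)
    show "inj_on (\<lambda>x. {x, r x}) (A - r ` A)"
      by (auto simp: inj_on_def doubleton_eq_iff)
    show "(\<lambda>x. {x, r x}) ` (A - r ` A) \<subseteq> ?P"
    proof
      fix p assume "p \<in> (\<lambda>x. {x, r x}) ` (A - r ` A)"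
      then obtain x where x: "p = {x, r x}" "x \<in> A" "x \<notin> r ` A" by blast
      then have "x \<noteq> r x" by blast
      then show "p \<in> ?P" using x r[of x] by (metis (mono_tags, lifting) mem_Collect_eq)
    qed
    have "?P \<subseteq> Pow A" by auto
    then show "finite ?P" by (rule finite_subset) (simp add: assms)
  qed
  finally show ?thesis .
qed

lemma ex_power_of_two_between:
  assumes "K \<ge> 2"
  obtains t where "2 ^ t < K" "K \<le> (2 :: nat) ^ Suc t"
proof -
  define P where "P = (\<lambda>s. K \<le> (2 :: nat) ^ s)"
  \<comment> \<open>Since \<open>K < 2 ^ K\<close>, a least exponent exists below this one.\<close>
  have "P K" by (simp add: P_def less_exp less_imp_le)
  moreover have "\<not> P 0" using assms by (simp add: P_def)
  ultimately obtain t where "\<not> P t" "P (Suc t)"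
    using ex_least_nat_less[of P K] by blast
  then show ?thesis by (intro that) (auto simp: P_def)
qed

section \<open>Basic facts on admissible tuples and maxima over pairs\<close>

lemma admissible_odd:
  assumes "admissible N K m" "N = 2 ^ n" "n \<ge> 1" "u < K"
  shows "odd (m u)"
proof
  assume "even (m u)"
  moreover have "even (int N)" using assms by simp
  ultimately have "2 dvd gcd (m u) (int N)" by (rule gcd_greatest)
  moreover have "gcd (m u) (int N) = 1" using assms by (simp only: admissible_def)
  ultimately show False by (metis odd_one)
qed

lemma admissible_diff:
  assumes "admissible N K m" "u < K" "v < K" "u \<noteq> v"
  shows "m v \<noteq> m u" "\<bar>m v - m u\<bar> < int N"
proof -
  have "inj_on m {..<K}"
    using assms(1) by (auto simp: admissible_def intro: strict_mono_on_imp_inj_on)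
  then show "m v \<noteq> m u" using assms by (auto simp: inj_on_def)
  show "\<bar>m v - m u\<bar> < int N"
    using assms by (auto simp: admissible_def abs_less_iff) (smt (verit))+
qed

lemma psi_max_pair_admissible:
  assumes "admissible N K m" "N = 2 ^ n" "u < K" "v < K" "u \<noteq> v"
  shows "psi_max_pair N m u v = sqrt (gcd (m v - m u) (int N) / real N)"
  using assms by (intro psi_max_pair_eq admissible_diff) auto

lemma finite_psi_max_pairs: "finite {psi_max_pair N m u v |u v. u < K \<and> v < K \<and> u \<noteq> v}"
proof -
  have "{psi_max_pair N m u v |u v. u < K \<and> v < K \<and> u \<noteq> v} \<subseteq>
      (\<lambda>(u, v). psi_max_pair N m u v) ` ({..<K} \<times> {..<K})"
    by auto
  then show ?thesis by (rule finite_subset) simp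
qed

lemma psi_max_pair_le_psi_max:
  assumes "u < K" "v < K" "u \<noteq> v"
  shows "psi_max_pair N m u v \<le> psi_max N K m"
  unfolding psi_max_def using assms by (intro Max_ge finite_psi_max_pairs) auto

lemma finite_index_pairs:
  "finite {{u, v} |u v. u < (K :: nat) \<and> v < K \<and> u \<noteq> v \<and> P u v}"
proof -
  have "{{u, v} |u v. u < K \<and> v < K \<and> u \<noteq> v \<and> P u v} \<subseteq> Pow {..<K}" by auto
  then show ?thesis by (rule finite_subset) simp
qed

text \<open>Halving an odd number and reducing modulo \<open>M\<close> names its class among the \<open>M\<close> odd classes
  modulo \<open>2 * M\<close>.\<close>

lemma card_congruent_pairs_ge:
  assumes "\<And>u. u < K \<Longrightarrow> odd (m u)" "M > 0"
  shows "K - M \<le> card {{u, v} |u v. u < K \<and> v < K \<and> u \<noteq> v \<and> 2 * int M dvd m v - m u}"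
proof -
  define f where "f u = (m u div 2) mod int M" for u
  have "f ` {..<K} \<subseteq> {0..<int M}" using assms(2) by (auto simp: f_def)
  then have "card (f ` {..<K}) \<le> M"
    using card_mono[of "{0..<int M}"] by fastforce
  then have "K - M \<le> card {{x, y} |x y. x \<in> {..<K} \<and> y \<in> {..<K} \<and> x \<noteq> y \<and> f x = f y}"
    using card_collisions_ge[of "{..<K}" f] by simp
  also have "\<dots> \<le> card {{u, v} |u v. u < K \<and> v < K \<and> u \<noteq> v \<and> 2 * int M dvd m v - m u}"
  proof (rule card_mono[OF finite_index_pairs])
    have "2 * int M dvd m y - m x" if "x < K" "y < K" "f x = f y" for x y
    proof -
      have "int M dvd m y div 2 - m x div 2"
        using that(3) by (simp add: f_def mod_eq_dvd_iff[symmetric])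
      then have "2 * int M dvd 2 * (m y div 2 - m x div 2)" by (rule mult_dvd_mono[OF dvd_refl])
      \<comment> \<open>Both roots are odd, so the remainders lost by \<open>div 2\<close>
        cancel.\<close>
      moreover have "m y - m x = 2 * (m y div 2 - m x div 2)"
        using assms(1)[OF that(1)] assms(1)[OF that(2)] by presburger
      ultimately show ?thesis by simp
    qed
    then show "{{x, y} |x y. x \<in> {..<K} \<and> y \<in> {..<K} \<and> x \<noteq> y \<and> f x = f y} \<subseteq>
        {{u, v} |u v. u < K \<and> v < K \<and> u \<noteq> v \<and> 2 * int M dvd m v - m u}"
      by blast
  qed
  finally show ?thesis .
qed

section \<open>Lower bounds for every admissible tuple\<close>

lemma congruent_psi_max_pair_ge:
  assumes "admissible N K m" "N = 2 ^ n" "2 * M dvd N"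
    and "u < K" "v < K" "u \<noteq> v" "2 * int M dvd m v - m u"
  shows "sqrt (real (2 * M) / real N) \<le> psi_max_pair N m u v"
proof -
  have "int (2 * M) dvd int N" using assms(3) by (simp only: int_dvd_int_iff)
  then have "2 * int M dvd gcd (m v - m u) (int N)" using assms by simp
  then have "2 * int M \<le> gcd (m v - m u) (int N)"
    using assms(2) by (intro zdvd_imp_le) auto
  then have "real (2 * M) \<le> real_of_int (gcd (m v - m u) (int N))" by linarith
  then show ?thesis
    by (simp add: psi_max_pair_admissible[OF assms(1,2,4-6)] divide_right_mono)
qed

text \<open>Since \<open>K - M > 0\<close>, the pigeonhole count supplies a pair congruent modulo
  \<open>2 * M\<close>, and one such pair suffices.\<close>

lemma psi_max_ge:
  assumes "admissible N K m" "N = 2 ^ n" "n \<ge> 1" "2 * M dvd N" "0 < M" "M < K"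
  shows "sqrt (real (2 * M) / real N) \<le> psi_max N K m"
proof -
  let ?C = "{{u, v} |u v. u < K \<and> v < K \<and> u \<noteq> v \<and> 2 * int M dvd m v - m u}"
  have "0 < card ?C"
    using card_congruent_pairs_ge[of K m M] admissible_odd[OF assms(1-3)] assms(5,6) by force
  then have "?C \<noteq> {}" by (metis card.empty less_irrefl)
  then obtain u v where uv: "u < K" "v < K" "u \<noteq> v" "2 * int M dvd m v - m u" by blast
  then show ?thesis
    using congruent_psi_max_pair_ge[OF assms(1,2,4) uv] psi_max_pair_le_psi_max[OF uv(1-3)]
    by (meson order_trans)
qed

text \<open>When the lower bound is attained, every pair congruent modulo \<open>2 * M\<close> is
  squeezed between it and the maximum, so all of them count.\<close>

lemma num_max_pairs_ge:
  assumes "admissible N K m" "N = 2 ^ n" "n \<ge> 1" "2 * M dvd N" "0 < M"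
    and max: "psi_max N K m = sqrt (real (2 * M) / real N)"
  shows "K - M \<le> num_max_pairs N K m"
proof -
  have "psi_max_pair N m u v = psi_max N K m"
    if "u < K" "v < K" "u \<noteq> v" "2 * int M dvd m v - m u" for u v
    using congruent_psi_max_pair_ge[OF assms(1,2,4) that]
      psi_max_pair_le_psi_max[OF that(1-3), of N m] max by simp
  then have "card {{u, v} |u v. u < K \<and> v < K \<and> u \<noteq> v \<and> 2 * int M dvd m v - m u} \<le>
      num_max_pairs N K m"
    unfolding num_max_pairs_def by (intro card_mono finite_index_pairs) blast
  then show ?thesis
    using card_congruent_pairs_ge[of K m M] admissible_odd[OF assms(1-3)] assms(5)
    by (meson order_trans)
qed

section \<open>The arithmetic progression\<close>

lemma gcd_power_of_two_eq_1_iff: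
  fixes a :: int
  assumes "n \<ge> 1"
  shows "gcd a (2 ^ n) = 1 \<longleftrightarrow> odd a"
  using assms by (simp add: coprime_iff_gcd_eq_1[symmetric])

lemma admissible_progression:
  assumes "n \<ge> 1" "N = 2 ^ n" "m0 > 0" "2 * (int K - 1) + m0 < int N" "odd m0"
  shows "admissible N K (\<lambda>u. 2 * int u + m0)"
  using assms gcd_power_of_two_eq_1_iff[OF assms(1)]
  by (auto simp: admissible_def strict_mono_on_def)

text \<open>The gcd is a power of two at most \<open>2 * \<bar>x\<bar>\<close>, hence below
  \<open>2 ^ (t + 2)\<close>; its exponent is therefore at most \<open>t + 1\<close>.\<close>

lemma progression_gcd_le:
  fixes x :: int
  assumes "x \<noteq> 0" "\<bar>x\<bar> < 2 ^ Suc t"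
  shows "gcd (2 * x) (2 ^ n) \<le> 2 * 2 ^ t"
proof -
  define g where "g = nat (gcd (2 * x) (2 ^ n))"
  have g: "int g = gcd (2 * x) (2 ^ n)" by (simp add: g_def)
  have "int g dvd int (2 ^ n)" by (simp add: g)
  then have "g dvd 2 ^ n" by (simp only: int_dvd_int_iff)
  then obtain i where i: "g = 2 ^ i" by (rule dvd_two_power_nat)
  have "int g \<le> \<bar>2 * x\<bar>" 
    using dvd_imp_le_int[of "2 * x" "int g"] assms(1) by (simp add: g)
  then have "(2 :: int) ^ i < 2 ^ Suc (Suc t)" using assms(2) by (simp add: i)
  then have "i \<le> Suc t" by (simp only: power_strict_increasing_iff)
  then have "(2 :: int) ^ i \<le> 2 ^ Suc t" by (intro power_increasing) auto
  then show ?thesis by (simp add: g[symmetric] i)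
qed

text \<open>Index differences are smaller than \<open>K\<close>, hence than
  \<open>2 ^ Suc t\<close>, which bounds every gcd from above. The general lower bound supplies the
  other inequality.\<close>

lemma psi_max_progression:
  assumes "admissible N K (\<lambda>u. 2 * int u + m0)" "N = 2 ^ n" "n \<ge> 1" "2 * 2 ^ t dvd N"
    and "2 ^ t < K" "K \<le> 2 ^ Suc t"
  shows "psi_max N K (\<lambda>u. 2 * int u + m0) = sqrt (real (2 * 2 ^ t) / real N)"
proof (rule antisym)
  let ?m = "\<lambda>u. 2 * int u + m0"
  have le: "psi_max_pair N ?m u v \<le> sqrt (real (2 * 2 ^ t) / real N)"
    if uv: "u < K" "v < K" "u \<noteq> v" for u v
  proof -
    have "int K \<le> int (2 ^ Suc t)" using assms(6) by (simp only: of_nat_le_iff)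
    then have "\<bar>int v - int u\<bar> < 2 ^ Suc t" using uv by simp
    then have "gcd (2 * (int v - int u)) (int N) \<le> 2 * 2 ^ t"
      using progression_gcd_le[of "int v - int u" t n] uv assms(2) by simp
    then have "real_of_int (gcd (2 * (int v - int u)) (int N)) \<le> real_of_int (2 * 2 ^ t)"
      by (simp only: of_int_le_iff)
    moreover have "?m v - ?m u = 2 * (int v - int u)" by simp
    ultimately show ?thesis
      by (simp only: psi_max_pair_admissible[OF assms(1,2) uv]) (simp add: divide_right_mono)
  qed
  \<comment> \<open>This yields two distinct indices, so the maximum is over a nonempty set.\<close>
  have "(1 :: nat) \<le> 2 ^ t" by simp
  then have "0 < K" "1 < K" using assms(5) by linarith+
  then have "\<exists>u v. u < K \<and> v < K \<and> u \<noteq> v" by (intro exI[of _ 0] exI[of _ 1]) auto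
  then show "psi_max N K ?m \<le> sqrt (real (2 * 2 ^ t) / real N)"
    unfolding psi_max_def using le
    by (intro Max.boundedI finite_psi_max_pairs) auto
  show "sqrt (real (2 * 2 ^ t) / real N) \<le> psi_max N K ?m"
    using assms(5) by (intro psi_max_ge[OF assms(1-4)]) auto
qed

text \<open>A maximal pair has gcd exactly \<open>2 * M\<close>, so \<open>M\<close> divides the
  index difference. Being nonzero and below \<open>2 * M\<close> in absolute value, that difference
  is \<open>M\<close> or \<open>- M\<close>.\<close>

lemma num_max_pairs_progression:
  assumes "admissible N K (\<lambda>u. 2 * int u + m0)" "N = 2 ^ n" "0 < M" "K \<le> 2 * M"
    and max: "psi_max N K (\<lambda>u. 2 * int u + m0) = sqrt (real (2 * M) / real N)"
  shows "num_max_pairs N K (\<lambda>u. 2 * int u + m0) \<le> K - M"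
proof -
  let ?m = "\<lambda>u. 2 * int u + m0"
  let ?P = "{{u, v} |u v. u < K \<and> v < K \<and> u \<noteq> v \<and> psi_max_pair N ?m u v = psi_max N K ?m}"
  have dist: "v = u + M \<or> u = v + M"
    if uv: "u < K" "v < K" "u \<noteq> v" and eq: "psi_max_pair N ?m u v = psi_max N K ?m" for u v
  proof -
    have diff: "?m v - ?m u = 2 * (int v - int u)" by simp
    have "real_of_int (gcd (?m v - ?m u) (int N)) / real N = real (2 * M) / real N"
      using eq unfolding max psi_max_pair_admissible[OF assms(1,2) uv] real_sqrt_eq_iff .
    then have "real_of_int (gcd (?m v - ?m u) (int N)) = real_of_int (2 * int M)"
      using assms(2) by simp
    then have "gcd (2 * (int v - int u)) (int N) = 2 * int M"
      unfolding diff by (simp only: of_int_eq_iff)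
    then have "2 * int M dvd 2 * (int v - int u)" by (metis gcd_dvd1)
    then have "int M dvd int v - int u" by (simp only: dvd_mult_cancel_left) simp
    then obtain c where c: "int v - int u = int M * c" by blast
    have "\<bar>int M * c\<bar> < 2 * int M" "int M * c \<noteq> 0"
      using uv assms(4) by (auto simp: c[symmetric])
    then have "int M * \<bar>c\<bar> < int M * 2" "c \<noteq> 0" by (auto simp: abs_mult)
    then have "\<bar>c\<bar> < 2" using assms(3) by (simp only: mult_less_cancel_left)
    then have "c = 1 \<or> c = -1" using \<open>c \<noteq> 0\<close> by linarith
    then show ?thesis using c by auto
  qed
  \<comment> \<open>Here \<open>w\<close> is the smaller index; \<open>w + M < K\<close> restricts
    it to \<open>w < K - M\<close>.\<close>
  have "?P \<subseteq> (\<lambda>w. {w, w + M}) ` {..<K - M}"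
  proof
    fix p assume "p \<in> ?P"
    then obtain u v where uv: "p = {u, v}" "u < K" "v < K" "v = u + M \<or> u = v + M"
      using dist by blast
    then show "p \<in> (\<lambda>w. {w, w + M}) ` {..<K - M}"
      by (auto simp: insert_commute)
  qed
  then have "card ?P \<le> card {..<K - M}"
    by (intro surj_card_le) auto
  then show ?thesis by (simp add: num_max_pairs_def)
qed

theorem theorem1:
  fixes n N K :: nat and m\<^sub>0 :: int
  assumes "n \<ge> 1" and "N = 2 ^ n" and "K \<ge> 2"
    and "m\<^sub>0 > 0" and "2 * (int K - 1) + m\<^sub>0 < int N"
  shows "((\<forall>u<K. gcd (2 * int u + m\<^sub>0) (int N) = 1) \<longleftrightarrow> odd m\<^sub>0) \<and>
         (odd m\<^sub>0 \<longrightarrow> optimal_roots N K (\<lambda>u. 2 * int u + m\<^sub>0))"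
proof (intro conjI impI)
  show "(\<forall>u<K. gcd (2 * int u + m\<^sub>0) (int N) = 1) \<longleftrightarrow> odd m\<^sub>0"
    \<comment> \<open>All terms have the parity of the first one, and index 0 recovers
      \<open>m\<^sub>0\<close> itself.\<close>
    using gcd_power_of_two_eq_1_iff[OF assms(1)] assms(2,3) by (auto intro: exI[of _ 0])
next
  assume "odd m\<^sub>0"
  let ?m = "\<lambda>u. 2 * int u + m\<^sub>0"
  have adm: "admissible N K ?m"
    using admissible_progression[OF assms(1,2,4,5) \<open>odd m\<^sub>0\<close>] .
  obtain t where t: "2 ^ t < K" "K \<le> 2 ^ Suc t"
    using ex_power_of_two_between[OF assms(3)] by blast
  \<comment> \<open>Since \<open>m\<^sub>0\<close> is at least 1, the progression fits only if
    \<open>2 * K\<close> is at most \<open>N\<close>. Then \<open>2 * 2 ^ t < N\<close>, and both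
    being powers of two, the smaller divides the larger.\<close>
  have "int (2 * K) \<le> int N" using assms(4,5) by simp
  then have "2 * K \<le> N" by (simp only: of_nat_le_iff)
  then have "(2 :: nat) ^ Suc t < 2 ^ n" using t(1) assms(2) by simp
  then have "Suc t < n" by (simp only: power_strict_increasing_iff)
  then have "(2 :: nat) ^ Suc t dvd 2 ^ n" by (intro le_imp_power_dvd) simp
  then have dvd: "2 * 2 ^ t dvd N" using assms(2) by simp
  have max: "psi_max N K ?m = sqrt (real (2 * 2 ^ t) / real N)"
    by (rule psi_max_progression[OF adm assms(2,1) dvd t])
  have lower: "psi_max N K ?m \<le> psi_max N K m" if "admissible N K m" for m
    using psi_max_ge[OF that assms(2,1) dvd _ t(1)] by (simp add: max)
  have min: "minimizes_psi_max N K ?m"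
    using adm lower by (auto simp: minimizes_psi_max_def is_arg_min_linorder)
  have "num_max_pairs N K ?m \<le> num_max_pairs N K m" if "minimizes_psi_max N K m" for m
  proof -
    have "admissible N K m" "psi_max N K m \<le> psi_max N K ?m"
      using that adm by (auto simp: minimizes_psi_max_def is_arg_min_linorder)
    \<comment> \<open>Every minimizer attains the same maximum as the progression, so the lower
      bound on the number of maximal pairs applies to it.\<close>
    then have "psi_max N K m = sqrt (real (2 * 2 ^ t) / real N)"
      using lower[of m] max by simp
    then have "K - 2 ^ t \<le> num_max_pairs N K m"
      using num_max_pairs_ge[OF \<open>admissible N K m\<close> assms(2,1) dvd] by simp
    moreover have "num_max_pairs N K ?m \<le> K - 2 ^ t"
      using num_max_pairs_progression[OF adm assms(2) _ _ max] t(2) by simp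
    ultimately show ?thesis by simp
  qed
  then show "optimal_roots N K ?m"
    using min by (auto simp: optimal_roots_def is_arg_min_linorder)
qed

end
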